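(* Let $G$ be a connected, nontrivial and closed-twin-free graph of order $n$, let $\mathrm{pf}(G)$ denote the number of proper-min-forced vertices of $G$, and let $\gamma^{ID}(G)$ denote the minimum cardinality of an identifying code in $G$. Then $\mathrm{pf}(G)/2 + \gamma^{ID}(G) \leq n$ and, in particular, $\mathrm{pf}(G) \leq \frac{2}{3}n$.
   Context: All graphs are simple, finite and undirected. The order of $G$ is $|V(G)|$; $G$ is nontrivial if its order is at least $2$. $N(v)$ is the open neighbourhood of a vertex $v$ and $N[v]=N(v)\cup\{v\}$ its closed neighbourhood. Distinct vertices $u,v$ are closed twins if $N[u]=N[v]$; a graph is closed-twin-free if it has no closed twins. A nonempty set $S\subseteq V(G)$ is called a code; for $v\in V(G)$ let $I(S;v)=S\cap N[v]$. A code $S$ is an identifying code in $G$ if $I(S;v)\neq\emptyset$ for all $v\in V(G)$ and $I(S;u)\neq I(S;v)$ for all distinct $u,v\in V(G)$. A minimum identifying code is an identifying code of the smallest cardinality $\gamma^{ID}(G)$. In a closed-twin-free graph $G$, a vertex is always-forced if it belongs to every identifying code in $G$; it is min-forced if it belongs to every minimum identifying code in $G$; it is proper-min-forced if it is min-forced but not always-forced. *)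

theory Defs
  imports Complex_Main "Graph_Theory.Digraph_Component"
begin

text \<open>
  Simple finite undirected graphs are the symmetric digraphs of locale \<^locale>\<open>graph\<close>: finite,
  without loops or parallel arcs, an edge being a pair of opposite arcs.
\<close>

definition open_nbhd :: "('a, 'b) pre_digraph \<Rightarrow> 'a \<Rightarrow> 'a set" where
  "open_nbhd G v = {u. v \<rightarrow>\<^bsub>G\<^esub> u}"

definition closed_nbhd :: "('a, 'b) pre_digraph \<Rightarrow> 'a \<Rightarrow> 'a set" where
  "closed_nbhd G v = open_nbhd G v \<union> {v}"

definition closed_twins :: "('a, 'b) pre_digraph \<Rightarrow> 'a \<Rightarrow> 'a \<Rightarrow> bool" where
  "closed_twins G u v \<longleftrightarrow>
     u \<in> verts G \<and> v \<in> verts G \<and> u \<noteq> v \<and> closed_nbhd G u = closed_nbhd G v"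

definition closed_twin_free :: "('a, 'b) pre_digraph \<Rightarrow> bool" where
  "closed_twin_free G \<longleftrightarrow> \<not> (\<exists>u v. closed_twins G u v)"

definition code :: "('a, 'b) pre_digraph \<Rightarrow> 'a set \<Rightarrow> bool" where
  "code G S \<longleftrightarrow> S \<noteq> {} \<and> S \<subseteq> verts G"

definition I_set :: "('a, 'b) pre_digraph \<Rightarrow> 'a set \<Rightarrow> 'a \<Rightarrow> 'a set" where
  "I_set G S v = S \<inter> closed_nbhd G v"

definition identifying_code :: "('a, 'b) pre_digraph \<Rightarrow> 'a set \<Rightarrow> bool" where
  "identifying_code G S \<longleftrightarrow> code G S \<and>
     (\<forall>v \<in> verts G. I_set G S v \<noteq> {}) \<and>
     (\<forall>u \<in> verts G. \<forall>v \<in> verts G. u \<noteq> v \<longrightarrow> I_set G S u \<noteq> I_set G S v)"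

text \<open>
  The following number is meaningful only if \<open>G\<close> has an identifying code. This holds when \<open>G\<close> is
  nonempty, finite and closed-twin-free, since \<open>verts G\<close> itself is then one.
\<close>

definition gamma_ID :: "('a, 'b) pre_digraph \<Rightarrow> nat" where
  "gamma_ID G = (LEAST k. \<exists>S. identifying_code G S \<and> card S = k)"

definition min_identifying_code :: "('a, 'b) pre_digraph \<Rightarrow> 'a set \<Rightarrow> bool" where
  "min_identifying_code G S \<longleftrightarrow> identifying_code G S \<and> card S = gamma_ID G"

definition always_forced :: "('a, 'b) pre_digraph \<Rightarrow> 'a \<Rightarrow> bool" where
  "always_forced G v \<longleftrightarrow> v \<in> verts G \<and> (\<forall>S. identifying_code G S \<longrightarrow> v \<in> S)"

definition min_forced :: "('a, 'b) pre_digraph \<Rightarrow> 'a \<Rightarrow> bool" where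
  "min_forced G v \<longleftrightarrow> v \<in> verts G \<and> (\<forall>S. min_identifying_code G S \<longrightarrow> v \<in> S)"

definition proper_min_forced :: "('a, 'b) pre_digraph \<Rightarrow> 'a \<Rightarrow> bool" where
  "proper_min_forced G v \<longleftrightarrow> min_forced G v \<and> \<not> always_forced G v"

definition pf :: "('a, 'b) pre_digraph \<Rightarrow> nat" where
  "pf G = card {v. proper_min_forced G v}"

end

theory Submission
  imports Defs
begin

text \<open>
  Fix a minimum identifying code \<open>S\<close>. The \<open>n\<close> traces \<open>I(S;v)\<close>, together with the empty set, form a
  family \<open>F\<close> of \<open>n + 1\<close> sets. Call \<open>s\<close> a label of the pair \<open>A\<close>, \<open>A \<union> {s}\<close> if both sets lie in \<open>F\<close>.
  By minimality every \<open>s \<in> S\<close> labels some pair. A proper-min-forced \<open>s\<close> labels at least two: if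
  it labelled only one, then exchanging \<open>s\<close> for a vertex that separates this pair would give a
  minimum identifying code without \<open>s\<close>. In any family in which each element of \<open>S\<close> is a label, at
  most \<open>2(|F| - |S| - 1)\<close> elements of \<open>S\<close> label two or more pairs. This is shown by deleting an
  element from all sets and using Bondy's bound \<open>|S| < |F|\<close>.
\<close>

section \<open>Labels in families of sets\<close>

text \<open>A pair labelled \<open>v\<close> is represented by its member without \<open>v\<close>,
  so the cardinality counts the pairs with label \<open>v\<close>.\<close>

definition lower_ends :: "'a set set \<Rightarrow> 'a \<Rightarrow> 'a set set" where
  "lower_ends F v = {A \<in> F. v \<notin> A \<and> insert v A \<in> F}"

lemma finite_lower_ends: "finite F \<Longrightarrow> finite (lower_ends F v)"
  by (simp add: lower_ends_def)

text \<open>Deleting \<open>v\<close> merges the two members of each pair labelled \<open>v\<close>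
  and identifies no other sets.\<close>

lemma card_delete_element:
  assumes "finite F"
  shows "card ((\<lambda>A. A - {v}) ` F) + card (lower_ends F v) = card F"
proof -
  let ?D = "\<lambda>A. A - {v}" and ?U = "insert v ` lower_ends F v"
  have sub: "?U \<subseteq> F" by (auto simp: lower_ends_def)
  \<comment> \<open>An upper member has the same image as its lower member, which avoids
    \<open>v\<close> and hence is not in \<open>?U\<close>.\<close>
  have "?D ` F = ?D ` (F - ?U)"
  proof
    show "?D ` F \<subseteq> ?D ` (F - ?U)"
    proof
      fix B assume "B \<in> ?D ` F"
      then obtain A where A: "A \<in> F" "B = A - {v}" by blast
      show "B \<in> ?D ` (F - ?U)"
      proof (cases "A \<in> ?U")
        case True
        then obtain C where C: "C \<in> lower_ends F v" "A = insert v C" by blast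
        then have "B = C - {v}" "C \<in> F - ?U" using A(2) by (auto simp: lower_ends_def)
        then show ?thesis by blast
      qed (use A in blast)
    qed
  qed blast
  moreover have "inj_on ?D (F - ?U)"
  proof (rule inj_onI)
    fix A B assume A: "A \<in> F - ?U" and B: "B \<in> F - ?U" and eq: "A - {v} = B - {v}"
    show "A = B"
    proof (rule ccontr)
      assume "A \<noteq> B"
      then have "(v \<notin> A \<and> B = insert v A) \<or> (v \<notin> B \<and> A = insert v B)" using eq by blast
      then show False using A B by (auto simp: lower_ends_def)
    qed
  qed
  ultimately have "card (?D ` F) = card (F - ?U)" by (metis card_image)
  moreover have "inj_on (insert v) (lower_ends F v)"
    by (auto simp: inj_on_def lower_ends_def)
  moreover have "card ?U \<le> card F" using assms sub by (rule card_mono)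
  ultimately show ?thesis
    using assms sub by (simp add: card_Diff_subset card_image finite_subset)
qed

text \<open>Labels other than \<open>v\<close> survive the deletion of \<open>v\<close>, so
  inductions on the label set can pass to the smaller family.\<close>

lemma lower_ends_delete_element:
  assumes "v \<noteq> w" "A \<in> lower_ends F w"
  shows "A - {v} \<in> lower_ends ((\<lambda>A. A - {v}) ` F) w"
proof -
  have "A - {v} \<in> (\<lambda>A. A - {v}) ` F" "insert w A - {v} \<in> (\<lambda>A. A - {v}) ` F"
    using assms by (auto simp: lower_ends_def)
  moreover have "insert w A - {v} = insert w (A - {v})" using assms(1) by blast
  ultimately show ?thesis using assms(2) by (auto simp: lower_ends_def)
qed

text \<open>Deleting a label from all sets costs the family at least one member.\<close>

lemma bondy:
  assumes "finite S" "finite F" "F \<noteq> {}" "\<And>v. v \<in> S \<Longrightarrow> lower_ends F v \<noteq> {}"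
  shows "card S < card F"
  using assms
proof (induction S arbitrary: F rule: finite_induct)
  case empty
  then show ?case by (simp add: card_gt_0_iff)
next
  case (insert v T)
  let ?F' = "(\<lambda>A. A - {v}) ` F"
  have "lower_ends ?F' w \<noteq> {}" if "w \<in> T" for w
    using insert.prems(3)[of w] insert.hyps that lower_ends_delete_element[of v w _ F] by blast
  then have "card T < card ?F'" using insert.IH[of ?F'] insert.prems by simp
  moreover have "card (lower_ends F v) > 0"
    using insert.prems by (simp add: card_gt_0_iff finite_lower_ends)
  ultimately show ?case
    using card_delete_element[OF insert.prems(1), of v] insert.hyps by simp
qed

text \<open>
  Deleting \<open>v\<close> can make two pairs labelled \<open>w\<close> coincide only if they span a square with two pairs
  labelled \<open>v\<close>. Then \<open>w\<close> labels a pair of the family \<open>lower_ends F v\<close>, to which Bondy's bound applies.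
\<close>

lemma card_repeated_labels_le:
  assumes "finite S" "finite F" "F \<noteq> {}" "\<And>v. v \<in> S \<Longrightarrow> lower_ends F v \<noteq> {}"
  shows "card {v \<in> S. card (lower_ends F v) \<ge> 2} + 2 * card S + 2 \<le> 2 * card F"
  using assms
proof (induction S arbitrary: F rule: finite_induct)
  case empty
  then have "card F > 0" by (simp add: card_gt_0_iff)
  then show ?case by simp
next
  case (insert v T)
  let ?F' = "(\<lambda>A. A - {v}) ` F"
  let ?m = "card (lower_ends F v)"
  let ?P = "{w \<in> T. card (lower_ends F w) \<ge> 2}"
  let ?P' = "{w \<in> T. card (lower_ends ?F' w) \<ge> 2}"
  let ?R = "{w \<in> T. lower_ends (lower_ends F v) w \<noteq> {}}"
  have "lower_ends ?F' w \<noteq> {}" if "w \<in> T" for w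
    using insert.prems(3)[of w] insert.hyps that lower_ends_delete_element[of v w _ F] by blast
  then have IH: "card ?P' + 2 * card T + 2 \<le> 2 * card ?F'"
    using insert.IH[of ?F'] insert.prems by simp
  have m: "card ?F' + ?m = card F" by (rule card_delete_element[OF insert.prems(1)])
  have R: "card ?R < ?m"
    using insert by (intro bondy) (auto simp: finite_lower_ends)
  have "?P \<subseteq> ?P' \<union> ?R"
  proof
    fix w assume w: "w \<in> ?P"
    have "w \<noteq> v" using w insert.hyps by blast
    show "w \<in> ?P' \<union> ?R"
    proof (cases "inj_on (\<lambda>A. A - {v}) (lower_ends F w)")
      case True
      have "(\<lambda>A. A - {v}) ` lower_ends F w \<subseteq> lower_ends ?F' w"
        using lower_ends_delete_element[OF \<open>w \<noteq> v\<close>[symmetric]] by (rule image_subsetI)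
      then have "card (lower_ends F w) \<le> card (lower_ends ?F' w)"
        using True insert.prems(1) by (metis card_image card_mono finite_imageI finite_lower_ends)
      then show ?thesis using w by auto
    next
      case False
      then obtain A B where AB: "A \<in> lower_ends F w" "B \<in> lower_ends F w"
        "A - {v} = B - {v}" "A \<noteq> B" by (auto simp: inj_on_def)
      then have "(v \<notin> A \<and> B = insert v A) \<or> (v \<notin> B \<and> A = insert v B)" by blast
      then obtain C where C: "v \<notin> C" "C \<in> lower_ends F w" "insert v C \<in> lower_ends F w"
        using AB(1,2) by metis
      have "C \<in> lower_ends (lower_ends F v) w"
        using C \<open>w \<noteq> v\<close> by (auto simp: lower_ends_def insert_commute)
      then show ?thesis using w by blast
    qed
  qed
  then have P: "card ?P \<le> card ?P' + card ?R"
    using insert.hyps by (intro order_trans[OF card_mono card_Un_le]) auto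
  show ?case
  \<comment> \<open>Passing to \<open>?F'\<close> lowers the right side by \<open>2 * ?m\<close>. On
    the left, \<open>v\<close> adds 2 through \<open>card S\<close>, \<open>?R\<close> adds at most
    \<open>?m - 1\<close>, and \<open>v\<close> itself adds 1 if \<open>?m \<ge> 2\<close>. This is
    at most \<open>?m + 2 \<le> 2 * ?m\<close> in that case; if \<open>?m = 1\<close>, then
    \<open>?R\<close> is empty and only the 2 remains.\<close>
  proof (cases "?m \<ge> 2")
    case True
    then have "{w \<in> insert v T. card (lower_ends F w) \<ge> 2} = insert v ?P" by blast
    then have "card {w \<in> insert v T. card (lower_ends F w) \<ge> 2} \<le> card ?P + 1"
      using insert.hyps by simp
    then show ?thesis using insert.hyps IH m R P True by simp
  next
    case False
    then have "{w \<in> insert v T. card (lower_ends F w) \<ge> 2} = ?P" by blast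
    then show ?thesis using insert.hyps IH m R P by simp
  qed
qed

section \<open>Minimum separating sets and the exchange argument\<close>

text \<open>Points have a type of their own, which leaves room for a point that is not a
  vertex.\<close>

definition separates :: "('x \<Rightarrow> 'a set) \<Rightarrow> 'x set \<Rightarrow> 'a set \<Rightarrow> bool" where
  "separates N X T \<longleftrightarrow> inj_on (\<lambda>x. T \<inter> N x) X"

text \<open>Traces that differ in \<open>S\<close> but agree without \<open>v\<close> differ in
  \<open>v\<close> alone. The names \<open>a\<close>, \<open>b\<close> record which of the two
  points has the lower trace.\<close>

lemma labelled_pair_of_collision:
  assumes "separates N X S" "x \<in> X" "y \<in> X" "x \<noteq> y"
    and "(S - {v}) \<inter> N x = (S - {v}) \<inter> N y"
  obtains a b where "{a, b} = {x, y}" "S \<inter> N a \<in> lower_ends ((\<lambda>x. S \<inter> N x) ` X) v"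
    "S \<inter> N b = insert v (S \<inter> N a)"
proof -
  have "S \<inter> N x \<noteq> S \<inter> N y" using assms by (auto simp: separates_def inj_on_def)
  then consider "v \<notin> S \<inter> N x" "S \<inter> N y = insert v (S \<inter> N x)"
    | "v \<notin> S \<inter> N y" "S \<inter> N x = insert v (S \<inter> N y)"
    using assms(5) by blast
  then show thesis
  proof cases
    case 1
    then have "S \<inter> N x \<in> lower_ends ((\<lambda>x. S \<inter> N x) ` X) v"
      using assms(2,3) by (force simp: lower_ends_def)
    then show thesis using that[of x y] 1 by blast
  next
    case 2
    then have "S \<inter> N y \<in> lower_ends ((\<lambda>x. S \<inter> N x) ` X) v"
      using assms(2,3) by (force simp: lower_ends_def)
    then show thesis using that[of y x] 2 by blast
  qed
qed

text \<open>The hypotheses \<open>min\<close>, \<open>forced\<close> and \<open>avoid\<close>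
  abstract a minimum code, min-forced and not always-forced. They make each element of
  \<open>S\<close> a label and each element of \<open>P\<close> a repeated one.\<close>

lemma card_unavoidable_le:
  assumes "finite X" "X \<noteq> {}" "finite S" "S \<subseteq> V" "separates N X S"
    and min: "\<And>T. T \<subseteq> V \<Longrightarrow> separates N X T \<Longrightarrow> finite T \<Longrightarrow> card S \<le> card T"
    and P: "P \<subseteq> S"
    and forced: "\<And>v T. v \<in> P \<Longrightarrow> T \<subseteq> V \<Longrightarrow> separates N X T \<Longrightarrow> finite T
      \<Longrightarrow> card T = card S \<Longrightarrow> v \<in> T"
    and avoid: "\<And>v. v \<in> P \<Longrightarrow> \<exists>T\<subseteq>V. separates N X T \<and> v \<notin> T"
  shows "card P + 2 * card S + 2 \<le> 2 * card X"
proof -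
  let ?F = "(\<lambda>x. S \<inter> N x) ` X"
  have ne: "lower_ends ?F v \<noteq> {}" if v: "v \<in> S" for v
  proof
    assume e: "lower_ends ?F v = {}"
    have "separates N X (S - {v})"
      unfolding separates_def
    proof (rule inj_onI, rule ccontr)
      fix x y assume "x \<in> X" "y \<in> X" "(S - {v}) \<inter> N x = (S - {v}) \<inter> N y" "x \<noteq> y"
      then show False using labelled_pair_of_collision[OF assms(5)] e by (metis empty_iff)
    qed
    then have "card S \<le> card (S - {v})" using min assms by blast
    then show False using v assms(3) by (metis card_Diff1_less not_le)
  qed
  have two: "card (lower_ends ?F v) \<ge> 2" if v: "v \<in> P" for v
  proof (rule ccontr)
    have vS: "v \<in> S" using v P by blast
    assume "\<not> 2 \<le> card (lower_ends ?F v)"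
    moreover have "card (lower_ends ?F v) > 0"
      using ne[OF vS] assms(1) by (simp add: card_gt_0_iff finite_lower_ends)
    ultimately have "card (lower_ends ?F v) = 1" by simp
    then obtain A where A: "lower_ends ?F v = {A}" by (rule card_1_singletonE)
    then have "A \<in> lower_ends ?F v" by simp
    then obtain a b where ab: "a \<in> X" "b \<in> X" "A = S \<inter> N a" "v \<notin> A" "insert v A = S \<inter> N b"
      unfolding lower_ends_def by auto
    \<comment> \<open>A separating set without \<open>v\<close> tells \<open>a\<close> and
      \<open>b\<close> apart by some \<open>t\<close> other than \<open>v\<close>; it lies outside
      \<open>S\<close>, whose traces at \<open>a\<close> and \<open>b\<close> differ only in
      \<open>v\<close>.\<close>
    obtain T where T: "T \<subseteq> V" "separates N X T" "v \<notin> T" using avoid[OF v] by blast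
    have "a \<noteq> b" using ab by blast
    then have "T \<inter> N a \<noteq> T \<inter> N b" using T(2) ab by (auto simp: separates_def inj_on_def)
    then obtain t where t: "t \<in> T" "(t \<in> N a) \<noteq> (t \<in> N b)" by blast
    have "t \<noteq> v" using t T by blast
    have "t \<notin> S" using ab t \<open>t \<noteq> v\<close> by blast
    let ?S' = "insert t (S - {v})"
    \<comment> \<open>A collision could only occur at the unique pair labelled \<open>v\<close>,
      that is at \<open>a\<close> and \<open>b\<close>, which \<open>t\<close> separates.\<close>
    have "separates N X ?S'"
      unfolding separates_def
    proof (rule inj_onI, rule ccontr)
      fix x y assume xy: "x \<in> X" "y \<in> X" "?S' \<inter> N x = ?S' \<inter> N y" "x \<noteq> y"
      have eq: "(S - {v}) \<inter> N x = (S - {v}) \<inter> N y" using xy(3) \<open>t \<notin> S\<close> by blast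
      obtain c d where cd: "{c, d} = {x, y}" "S \<inter> N c \<in> lower_ends ?F v"
        "S \<inter> N d = insert v (S \<inter> N c)"
        using labelled_pair_of_collision[OF assms(5) xy(1,2,4) eq] by blast
      have "S \<inter> N c = S \<inter> N a" "S \<inter> N d = S \<inter> N b" using cd A ab by auto
      moreover have "c \<in> X" "d \<in> X" using cd(1) xy by auto
      ultimately have "c = a" "d = b" using assms(5) ab(1,2) by (auto simp: separates_def inj_on_def)
      then have "?S' \<inter> N a = ?S' \<inter> N b" using cd(1) xy(3) by (auto simp: doubleton_eq_iff)
      then show False using t(2) by blast
    qed
    moreover have "card ?S' = card S"
      using card_Suc_Diff1[OF assms(3) vS] \<open>t \<notin> S\<close> assms(3)
      by (simp del: card_Diff_singleton_if card_Diff_singleton card_Diff_insert)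
    moreover have "?S' \<subseteq> V" using T t assms(4) by blast
    ultimately have "v \<in> ?S'" using assms(3) by (intro forced[OF v]) simp_all
    then show False using \<open>t \<noteq> v\<close> by blast
  qed
  have "P \<subseteq> {v \<in> S. card (lower_ends ?F v) \<ge> 2}" using two P by blast
  then have "card P \<le> card {v \<in> S. card (lower_ends ?F v) \<ge> 2}"
    using assms(3) by (intro card_mono) auto
  moreover have "card ?F = card X" using assms(5) by (simp add: separates_def card_image)
  ultimately show ?thesis
    using card_repeated_labels_le[of S ?F] ne assms(1-3) by simp
qed

section \<open>Application to identifying codes\<close>

text \<open>Domination becomes separation from an extra point \<^term>\<open>None\<close> with empty neighbourhood.\<close>

fun nbhd_opt :: "('a, 'b) pre_digraph \<Rightarrow> 'a option \<Rightarrow> 'a set" where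
  "nbhd_opt G None = {}"
| "nbhd_opt G (Some v) = closed_nbhd G v"

lemma identifying_code_iff_separates:
  assumes "verts G \<noteq> {}"
  shows "identifying_code G T \<longleftrightarrow>
    T \<subseteq> verts G \<and> separates (nbhd_opt G) (insert None (Some ` verts G)) T"
proof -
  have "separates (nbhd_opt G) (insert None (Some ` verts G)) T \<longleftrightarrow>
    (\<forall>v \<in> verts G. I_set G T v \<noteq> {}) \<and>
    (\<forall>u \<in> verts G. \<forall>v \<in> verts G. u \<noteq> v \<longrightarrow> I_set G T u \<noteq> I_set G T v)"
    unfolding separates_def I_set_def inj_on_def by (auto 0 3)
  \<comment> \<open>A set that dominates some vertex is nonempty, as \<open>code\<close>
    demands.\<close>
  moreover have "T \<noteq> {}" if "\<forall>v \<in> verts G. I_set G T v \<noteq> {}"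
    using that assms by (auto simp: I_set_def)
  ultimately show ?thesis unfolding identifying_code_def code_def by blast
qed

lemma (in wf_digraph) identifying_code_verts:
  assumes "closed_twin_free G" "verts G \<noteq> {}"
  shows "identifying_code G (verts G)"
proof -
  have "I_set G (verts G) v = closed_nbhd G v" if "v \<in> verts G" for v
    using that by (auto simp: I_set_def closed_nbhd_def open_nbhd_def dest: adj_in_verts)
  moreover have "v \<in> closed_nbhd G v" for v by (simp add: closed_nbhd_def)
  ultimately show ?thesis
    using assms unfolding identifying_code_def code_def closed_twin_free_def closed_twins_def
    by (metis empty_iff order_refl)
qed

lemma gamma_ID_le: "identifying_code G T \<Longrightarrow> gamma_ID G \<le> card T"
  unfolding gamma_ID_def by (rule Least_le) blast

lemma ex_min_identifying_code:
  assumes "identifying_code G T"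
  shows "\<exists>S. min_identifying_code G S"
  unfolding min_identifying_code_def gamma_ID_def
  by (rule LeastI_ex) (use assms in blast)

theorem theorem13:
  fixes G :: "('a, 'b) pre_digraph" and n :: nat
  assumes "graph G"
    and "connected G"
    and "closed_twin_free G"
    and "card (verts G) = n"
    and "n \<ge> 2"
  shows "real (pf G) / 2 + real (gamma_ID G) \<le> real n \<and> real (pf G) \<le> 2 / 3 * real n"
proof -
  interpret graph G by fact
  let ?P = "{v. proper_min_forced G v}"
  let ?X = "insert None (Some ` verts G)"
  have ne: "verts G \<noteq> {}" using assms(4,5) by auto
  note sep = identifying_code_iff_separates[OF ne]
  obtain S where S: "identifying_code G S" "card S = gamma_ID G"
    using ex_min_identifying_code[OF identifying_code_verts[OF assms(3) ne]]
    by (auto simp: min_identifying_code_def)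
  have SV: "S \<subseteq> verts G" using S(1) sep by blast
  have fin: "finite S" using SV finite_verts by (rule finite_subset)
  have PS: "?P \<subseteq> S"
    using S by (auto simp: proper_min_forced_def min_forced_def min_identifying_code_def)
  have "card ?P + 2 * card S + 2 \<le> 2 * card ?X"
  proof (rule card_unavoidable_le[where N = "nbhd_opt G" and V = "verts G"])
    fix T assume "T \<subseteq> verts G" "separates (nbhd_opt G) ?X T"
    then show "card S \<le> card T" using gamma_ID_le S(2) sep by metis
  next
    fix v T assume "v \<in> ?P" "T \<subseteq> verts G" "separates (nbhd_opt G) ?X T" "card T = card S"
    then show "v \<in> T" using S(2) sep
      by (auto simp: proper_min_forced_def min_forced_def min_identifying_code_def)
  next
    fix v assume "v \<in> ?P"
    then show "\<exists>T\<subseteq>verts G. separates (nbhd_opt G) ?X T \<and> v \<notin> T"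
      using sep by (auto simp: proper_min_forced_def min_forced_def always_forced_def)
  qed (use S(1) sep SV fin PS in auto)
  \<comment> \<open>The extra point contributes exactly the 2 that cancels the \<open>+ 2\<close> on
    the left.\<close>
  moreover have "card ?X = n + 1"
    using assms(4) by (simp add: card_image)
  ultimately have "pf G + 2 * gamma_ID G \<le> 2 * n" using S(2) by (simp add: pf_def)
  \<comment> \<open>Then \<open>3 * pf G \<le> pf G + 2 * gamma_ID G \<le> 2 * n\<close>, the second
    bound.\<close>
  moreover have "pf G \<le> gamma_ID G"
    unfolding pf_def S(2)[symmetric] by (rule card_mono[OF fin PS])
  ultimately show ?thesis by linarith
qed

end
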